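(* Let $d \ge 2$, let $\mathbf{x} \in \mathbb{R}^{n_1 \times \cdots \times n_d}$ be a tensor given in TT-format by cores $\mathbf{x}^{(1)}, \dots, \mathbf{x}^{(d)}$, and let $1 \le l \le d-1$. Let $X \in \mathbb{R}^{(n_1 \cdots n_l) \times (n_{l+1} \cdots n_d)}$ be the matricization of $\mathbf{x}$ with respect to the dimensions $(1,\dots,l)$ and $(l+1,\dots,d)$. Then the pseudoinverse procedure described in the context, applied to $\mathbf{x}^{(1)}, \dots, \mathbf{x}^{(d)}$ and $l$, computes the pseudoinverse of $X$; that is, for the matrices $M$, $\Sigma$, $N$ produced by the procedure, $$X^+ = N^T \, \Sigma^{-1} \, M^T ,$$ where $X^+$ denotes the Moore--Penrose pseudoinverse of $X$.
   Context: **Multi-indices.** For $(n_1,\dots,n_k)$ and $1\le i_\mu\le n_\mu$, write $\overline{i_1,\dots,i_k} = 1+\sum_{\mu=1}^k (i_\mu-1)\prod_{\nu=1}^{\mu-1} n_\nu$ (little-endian bijection onto $\{1,\dots,n_1\cdots n_k\}$). **Matricization.** The matricization of $\mathbf{x}\in\mathbb{R}^{n_1\times\cdots\times n_d}$ with respect to the dimensions $(1,\dots,l)$ and $(l+1,\dots,d)$ is the matrix $X$ with $X_{\overline{i_1,\dots,i_l},\,\overline{i_{l+1},\dots,i_d}} = \mathbf{x}_{i_1,\dots,i_d}$. **TT-format.** $\mathbf{x}$ is given in TT-format by cores $\mathbf{x}^{(\mu)}\in\mathbb{R}^{r_{\mu-1}\times n_\mu\times r_\mu}$, $\mu=1,\dots,d$,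 with $r_0=r_d=1$, if $$\mathbf{x}_{i_1,\dots,i_d}=\sum_{k_0=1}^{r_0}\cdots\sum_{k_d=1}^{r_d}\mathbf{x}^{(1)}_{k_0,i_1,k_1}\cdots\mathbf{x}^{(d)}_{k_{d-1},i_d,k_d}.$$ **Core unfoldings.** For a core $\mathbf{c}\in\mathbb{R}^{r\times n\times r'}$ let $\mathcal{L}(\mathbf{c})\in\mathbb{R}^{(rn)\times r'}$ be given by $\mathcal{L}(\mathbf{c})_{\overline{i,j},k}=\mathbf{c}_{i,j,k}$, and let $\mathcal{R}(\mathbf{c})\in\mathbb{R}^{r\times(nr')}$ be given by $\mathcal{R}(\mathbf{c})_{i,\overline{j,k}}=\mathbf{c}_{i,j,k}$. **Left-orthonormalization of $\mathbf{x}^{(1)},\dots,\mathbf{x}^{(p)}$** ($p\le d-1$; nothing is done if $p=0$). For $\mu=1,\dots,p$: compute a QR factorization $\mathcal{L}(\mathbf{x}^{(\mu)})=QR$ with $Q\in\mathbb{R}^{(r_{\mu-1}n_\mu)\times s}$, $Q^TQ=I$; define $\mathbf{y}\in\mathbb{R}^{r_{\mu-1}\times n_\mu\times s}$ by $\mathcal{L}(\mathbf{y})=Q$ and $\mathbf{z}\in\mathbb{R}^{s\times n_{\mu+1}\times r_{\mu+1}}$ by $\mathcal{R}(\mathbf{z})=R\,\mathcal{R}(\mathbf{x}^{(\mu+1)})$; replace $\mathbf{x}^{(\mu)}$ by $\mathbf{y}$, $\mathbf{x}^{(\mu+1)}$ by $\mathbf{z}$ and $r_\mu$ by $s$. **Right-orthonormalization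 of $\mathbf{x}^{(d)},\dots,\mathbf{x}^{(p)}$** ($p\ge 2$). For $\mu=d,d-1,\dots,p$: compute a QR factorization of $\mathcal{R}(\mathbf{x}^{(\mu)})^T$, i.e. $\mathcal{R}(\mathbf{x}^{(\mu)})=R^TQ^T$ with $Q^T\in\mathbb{R}^{s\times(n_\mu r_\mu)}$, $Q^TQ=I$; define $\mathbf{y}\in\mathbb{R}^{s\times n_\mu\times r_\mu}$ by $\mathcal{R}(\mathbf{y})=Q^T$ and $\mathbf{z}\in\mathbb{R}^{r_{\mu-2}\times n_{\mu-1}\times s}$ by $\mathcal{L}(\mathbf{z})=\mathcal{L}(\mathbf{x}^{(\mu-1)})\,R^T$; replace $\mathbf{x}^{(\mu)}$ by $\mathbf{y}$, $\mathbf{x}^{(\mu-1)}$ by $\mathbf{z}$ and $r_{\mu-1}$ by $s$. **Pseudoinverse procedure** (input: cores of $\mathbf{x}$ and $1\le l\le d-1$). 1. Left-orthonormalize $\mathbf{x}^{(1)},\dots,\mathbf{x}^{(l-1)}$ by the QR-based left-orthonormalization with $p=l-1$ (sweeping $\mu=1,\dots,l-1$, factoring $\mathcal{L}(\mathbf{x}^{(\mu)})=QR$, keeping $Q$ as the new core $\mu$ and multiplying $R$ into core $\mu+1$), and right-orthonormalize $\mathbf{x}^{(d)},\dots,\mathbf{x}^{(l+1)}$ by the QR-based right-orthonormalization with $p=l+1$ (sweeping $\mu=d,d-1,\dots,l+1$, factoring $\mathcal{R}(\mathbf{x}^{(\mu)})=R^TQ^T$, keeping $Q^T$ as the new core $\mu$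 and multiplying $R^T$ into core $\mu-1$). 2. Compute a compact SVD $\mathcal{L}(\mathbf{x}^{(l)})=U\Sigma V^T$ with $U^TU=I$, $V^TV=I$, and $\Sigma\in\mathbb{R}^{s\times s}$ diagonal containing exactly the nonzero (positive) singular values (in the degenerate case $s=0$, products through the empty inner dimension are zero matrices). 3. Define $\mathbf{y}\in\mathbb{R}^{r_{l-1}\times n_l\times s}$ by $\mathcal{L}(\mathbf{y})=U$ and $\mathbf{z}\in\mathbb{R}^{s\times n_{l+1}\times r_{l+1}}$ by $\mathcal{R}(\mathbf{z})=V^T\,\mathcal{R}(\mathbf{x}^{(l+1)})$. Replace $\mathbf{x}^{(l)}$ by $\mathbf{y}$, $\mathbf{x}^{(l+1)}$ by $\mathbf{z}$ and $r_l$ by $s$. 4. With the resulting cores, define $M\in\mathbb{R}^{(n_1\cdots n_l)\times r_l}$ and $N\in\mathbb{R}^{r_l\times(n_{l+1}\cdots n_d)}$ by $$M_{\overline{i_1,\dots,i_l},k_l}=\sum_{k_0=1}^{r_0}\cdots\sum_{k_{l-1}=1}^{r_{l-1}}\mathbf{x}^{(1)}_{k_0,i_1,k_1}\cdots\mathbf{x}^{(l)}_{k_{l-1},i_l,k_l},\qquad N_{k_l,\overline{i_{l+1},\dots,i_d}}=\sum_{k_{l+1}=1}^{r_{l+1}}\cdots\sum_{k_d=1}^{r_d}\mathbf{x}^{(l+1)}_{k_l,i_{l+1},k_{l+1}}\cdots\mathbf{x}^{(d)}_{k_{d-1},i_d,k_d}.$$ 5. Output $N^T\Sigma^{-1}M^T$.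 *)

theory Defs
  imports
    "Jordan_Normal_Form.Gauss_Jordan_Elimination"
    "HOL-Library.FuncSet"
begin

text \<open>
  Modes and cores are numbered from 1 to \<open>d\<close>, but all entry indices (of matrices, cores and
  tensors) start at 0, as matrix indices do in \<^theory>\<open>Jordan_Normal_Form.Matrix\<close>. Hence
  \<open>1 \<le> i\<^sub>\<mu> \<le> n\<^sub>\<mu>\<close> becomes \<open>i \<mu> < n \<mu>\<close>, and \<open>mindex n a b i\<close> below is one less than the 1-based
  multi-index of \<open>i\<^sub>a, \<dots>, i\<^sub>b\<close>; for two indices \<open>i < r\<close>, \<open>j < n\<close> it is \<open>i + j * r\<close>.
\<close>


section \<open>Multi-indices\<close>

definition mindex :: "(nat \<Rightarrow> nat) \<Rightarrow> nat \<Rightarrow> nat \<Rightarrow> (nat \<Rightarrow> nat) \<Rightarrow> nat" where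
  "mindex n a b i = (\<Sum>\<mu>=a..b. i \<mu> * (\<Prod>\<nu>=a..<\<mu>. n \<nu>))"

text \<open>\<open>mdigit n a p\<close> recovers the multi-index with first mode \<open>a\<close> encoded by \<open>p\<close>; see
  \<open>mdigit_mindex\<close>.\<close>

definition mdigit :: "(nat \<Rightarrow> nat) \<Rightarrow> nat \<Rightarrow> nat \<Rightarrow> nat \<Rightarrow> nat" where
  "mdigit n a p \<mu> = p div (\<Prod>\<nu>=a..<\<mu>. n \<nu>) mod n \<mu>"

lemma mindex_less:
  assumes "\<And>\<mu>. a \<le> \<mu> \<Longrightarrow> \<mu> \<le> b \<Longrightarrow> i \<mu> < n \<mu>"
  shows "mindex n a b i < (\<Prod>\<mu>=a..b. n \<mu>)"
proof (cases "a \<le> b")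
  case False
  then show ?thesis by (simp add: mindex_def)
next
  case True
  then show ?thesis using assms
  proof (induction b rule: dec_induct)
    case base
    then show ?case by (simp add: mindex_def)
  next
    case (step b)
    define P where "P = (\<Prod>\<mu>=a..b. n \<mu>)"
    have IH: "mindex n a b i < P" unfolding P_def using step by simp
    have "mindex n a (Suc b) i = mindex n a b i + i (Suc b) * P"
      using step(1) by (simp add: mindex_def P_def atLeastLessThanSuc_atLeastAtMost)
    also have "\<dots> < P + i (Suc b) * P" using IH by simp
    also have "\<dots> = Suc (i (Suc b)) * P" by simp
    also have "\<dots> \<le> n (Suc b) * P"
      using step(1) step.prems[of "Suc b"] by (intro mult_le_mono1) simp
    finally show ?case using step(1) by (simp add: P_def mult.commute)
  qed
qed

lemma mdigit_mindex:
  assumes "\<And>\<mu>. a \<le> \<mu> \<Longrightarrow> \<mu> \<le> b \<Longrightarrow> i \<mu> < n \<mu>" and "a \<le> \<mu>" "\<mu> \<le> b"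
  shows "mdigit n a (mindex n a b i) \<mu> = i \<mu>"
proof -
  define P where "P = (\<Prod>\<nu>=a..<\<mu>. n \<nu>)"
  have less: "(\<Sum>\<nu>=a..<\<mu>. i \<nu> * (\<Prod>\<xi>=a..<\<nu>. n \<xi>)) < P"
  proof (cases "a < \<mu>")
    case True
    then obtain m where m: "\<mu> = Suc m" "a \<le> m" by (cases \<mu>) auto
    then show ?thesis
      using mindex_less[of a m i n] assms
      by (auto simp: mindex_def P_def atLeastLessThanSuc_atLeastAtMost)
  next
    case False
    then show ?thesis by (simp add: P_def)
  qed
  then have P: "P > 0" by simp
  have "{a..b} = insert \<mu> ({a..<\<mu>} \<union> {\<mu><..b})" "{a..<\<mu>} \<inter> {\<mu><..b} = {}"
    using assms(2,3) by auto
  then have "mindex n a b i = (\<Sum>\<nu>=a..<\<mu>. i \<nu> * (\<Prod>\<xi>=a..<\<nu>. n \<xi>)) + i \<mu> * P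
      + (\<Sum>\<nu>\<in>{\<mu><..b}. i \<nu> * (\<Prod>\<xi>=a..<\<nu>. n \<xi>))"
    by (simp add: mindex_def P_def sum.union_disjoint)
  moreover have "(P * n \<mu>) dvd (\<Sum>\<nu>\<in>{\<mu><..b}. i \<nu> * (\<Prod>\<xi>=a..<\<nu>. n \<xi>))"
  proof (rule dvd_sum)
    fix \<nu> assume "\<nu> \<in> {\<mu><..b}"
    then have "{a..<\<nu>} = insert \<mu> ({a..<\<mu>} \<union> {\<mu><..<\<nu>})" "{a..<\<mu>} \<inter> {\<mu><..<\<nu>} = {}"
      using assms(2) by auto
    then have "(\<Prod>\<xi>=a..<\<nu>. n \<xi>) = P * (n \<mu> * (\<Prod>\<xi>\<in>{\<mu><..<\<nu>}. n \<xi>))"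
      unfolding P_def by (simp add: prod.union_disjoint)
    then show "(P * n \<mu>) dvd (i \<nu> * (\<Prod>\<xi>=a..<\<nu>. n \<xi>))" by simp
  qed
  then obtain t where
    "(\<Sum>\<nu>\<in>{\<mu><..b}. i \<nu> * (\<Prod>\<xi>=a..<\<nu>. n \<xi>)) = P * n \<mu> * t" ..
  ultimately have
    "mindex n a b i = (\<Sum>\<nu>=a..<\<mu>. i \<nu> * (\<Prod>\<xi>=a..<\<nu>. n \<xi>)) + P * (i \<mu> + n \<mu> * t)"
    by (simp add: distrib_left)
  then have "mindex n a b i div P = i \<mu> + n \<mu> * t"
    using less P by simp
  then show ?thesis
    using assms by (simp add: mdigit_def flip: P_def)
qed


section \<open>Tensors, cores and their unfoldings\<close>

text \<open>A tensor with mode sizes \<open>n 1, \<dots>, n d\<close> is a function on the multi-indices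
  \<open>\<Pi>\<^sub>E \<mu>\<in>{1..d}. {..<n \<mu>}\<close>.\<close>

type_synonym tensor = "(nat \<Rightarrow> nat) \<Rightarrow> real"

definition matricization :: "nat \<Rightarrow> (nat \<Rightarrow> nat) \<Rightarrow> nat \<Rightarrow> tensor \<Rightarrow> real mat" where
  "matricization d n l x = mat (\<Prod>\<mu>=1..l. n \<mu>) (\<Prod>\<mu>=l+1..d. n \<mu>)
     (\<lambda>(p, q). x (\<lambda>\<mu>\<in>{1..d}. if \<mu> \<le> l then mdigit n 1 p \<mu> else mdigit n (l+1) q \<mu>))"

lemma matricization_index:
  assumes "i \<in> (\<Pi>\<^sub>E \<mu>\<in>{1..d}. {..<n \<mu>})" and "l \<le> d"
  shows "matricization d n l x $$ (mindex n 1 l i, mindex n (l+1) d i) = x i"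
proof -
  have i: "i \<mu> < n \<mu>" if "1 \<le> \<mu>" "\<mu> \<le> d" for \<mu>
    using assms(1) that by (auto simp: PiE_iff)
  have "(\<lambda>\<mu>\<in>{1..d}. if \<mu> \<le> l then mdigit n 1 (mindex n 1 l i) \<mu>
           else mdigit n (l+1) (mindex n (l+1) d i) \<mu>) = i"
  proof
    fix \<mu>
    show "(\<lambda>\<mu>\<in>{1..d}. if \<mu> \<le> l then mdigit n 1 (mindex n 1 l i) \<mu>
           else mdigit n (l+1) (mindex n (l+1) d i) \<mu>) \<mu> = i \<mu>"
      using assms i mdigit_mindex[of 1 l i n \<mu>] mdigit_mindex[of "l+1" d i n \<mu>]
      by (auto simp: PiE_iff extensional_def)
  qed
  moreover have "mindex n 1 l i < (\<Prod>\<mu>=1..l. n \<mu>)" "mindex n (l+1) d i < (\<Prod>\<mu>=l+1..d. n \<mu>)"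
    using i assms(2) by (auto intro!: mindex_less)
  ultimately show ?thesis by (simp add: matricization_def del: One_nat_def Suc_eq_plus1 add_Suc_right add_0_right)
qed

text \<open>The sizes \<open>r \<times> n \<times> r'\<close> of a core are kept separately; its entries outside this range are
  irrelevant.\<close>

type_synonym core = "nat \<Rightarrow> nat \<Rightarrow> nat \<Rightarrow> real"

definition unfold_left :: "nat \<Rightarrow> nat \<Rightarrow> nat \<Rightarrow> core \<Rightarrow> real mat" where
  "unfold_left r n r' c = mat (r * n) r' (\<lambda>(p, k). c (p mod r) (p div r) k)"

definition unfold_right :: "nat \<Rightarrow> nat \<Rightarrow> nat \<Rightarrow> core \<Rightarrow> real mat" where
  "unfold_right r n r' c = mat r (n * r') (\<lambda>(i, q). c i (q mod n) (q div n))"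

lemma pair_index_less: "i < r \<Longrightarrow> j < n \<Longrightarrow> i + j * r < r * (n::nat)"
proof -
  assume "i < r" "j < n"
  then have "i + j * r < Suc j * r" by simp
  also have "\<dots> \<le> n * r" using \<open>j < n\<close> by (intro mult_le_mono1) simp
  finally show ?thesis by (simp add: mult.commute)
qed

lemma unfold_left_index:
  "i < r \<Longrightarrow> j < n \<Longrightarrow> k < r' \<Longrightarrow> unfold_left r n r' c $$ (i + j * r, k) = c i j k"
  by (simp add: unfold_left_def pair_index_less)

lemma unfold_right_index:
  "i < r \<Longrightarrow> j < n \<Longrightarrow> k < r' \<Longrightarrow> unfold_right r n r' c $$ (i, j + k * n) = c i j k"
  by (simp add: unfold_right_def pair_index_less)


section \<open>The TT-format\<close>

text \<open>A list of cores is a pair \<open>(r, c)\<close> of the ranks \<open>r 0, \<dots>, r d\<close> and the cores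
  \<open>c 1, \<dots>, c d\<close>, where \<open>c \<mu>\<close> has size \<open>r (\<mu>-1) \<times> n \<mu> \<times> r \<mu>\<close>.\<close>

type_synonym cores = "(nat \<Rightarrow> nat) \<times> (nat \<Rightarrow> core)"

definition core_prod :: "(nat \<Rightarrow> core) \<Rightarrow> nat \<Rightarrow> nat \<Rightarrow> (nat \<Rightarrow> nat) \<Rightarrow> (nat \<Rightarrow> nat) \<Rightarrow> real" where
  "core_prod c a b i k = (\<Prod>\<mu>=a..b. c \<mu> (k (\<mu>-1)) (i \<mu>) (k \<mu>))"

definition tt_format :: "nat \<Rightarrow> (nat \<Rightarrow> nat) \<Rightarrow> cores \<Rightarrow> tensor \<Rightarrow> bool" where
  "tt_format d n = (\<lambda>(r, c) x. r 0 = 1 \<and> r d = 1 \<and>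
     (\<forall>i \<in> (\<Pi>\<^sub>E \<mu>\<in>{1..d}. {..<n \<mu>}).
        x i = (\<Sum>k \<in> (\<Pi>\<^sub>E \<mu>\<in>{0..d}. {..<r \<mu>}). core_prod c 1 d i k)))"

text \<open>The matrices \<open>M\<close> and \<open>N\<close>: the summation index \<open>k\<close> omits position \<open>l\<close>, which is set to the
  column (respectively row) index.\<close>

definition left_interface :: "(nat \<Rightarrow> nat) \<Rightarrow> nat \<Rightarrow> cores \<Rightarrow> real mat" where
  "left_interface n l = (\<lambda>(r, c). mat (\<Prod>\<mu>=1..l. n \<mu>) (r l)
     (\<lambda>(p, kl). \<Sum>k \<in> (\<Pi>\<^sub>E \<mu>\<in>{0..<l}. {..<r \<mu>}). core_prod c 1 l (mdigit n 1 p) (k(l := kl))))"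

definition right_interface :: "nat \<Rightarrow> (nat \<Rightarrow> nat) \<Rightarrow> nat \<Rightarrow> cores \<Rightarrow> real mat" where
  "right_interface d n l = (\<lambda>(r, c). mat (r l) (\<Prod>\<mu>=l+1..d. n \<mu>)
     (\<lambda>(kl, q). \<Sum>k \<in> (\<Pi>\<^sub>E \<mu>\<in>{l+1..d}. {..<r \<mu>}).
        core_prod c (l+1) d (mdigit n (l+1) q) (k(l := kl))))"

lemma left_interface_index:
  assumes "\<And>\<mu>. 1 \<le> \<mu> \<Longrightarrow> \<mu> \<le> l \<Longrightarrow> i \<mu> < n \<mu>" and "kl < r l"
  shows "left_interface n l (r, c) $$ (mindex n 1 l i, kl) =
    (\<Sum>k \<in> (\<Pi>\<^sub>E \<mu>\<in>{0..<l}. {..<r \<mu>}). core_prod c 1 l i (k(l := kl)))"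
  using assms mindex_less[of 1 l i n] mdigit_mindex[of 1 l i n]
  by (auto simp: left_interface_def core_prod_def intro!: sum.cong prod.cong)

lemma right_interface_index:
  assumes "\<And>\<mu>. l + 1 \<le> \<mu> \<Longrightarrow> \<mu> \<le> d \<Longrightarrow> i \<mu> < n \<mu>" and "kl < r l"
  shows "right_interface d n l (r, c) $$ (kl, mindex n (l+1) d i) =
    (\<Sum>k \<in> (\<Pi>\<^sub>E \<mu>\<in>{l+1..d}. {..<r \<mu>}). core_prod c (l+1) d i (k(l := kl)))"
  using assms mindex_less[of "l+1" d i n] mdigit_mindex[of "l+1" d i n]
  by (auto simp: right_interface_def core_prod_def intro!: sum.cong prod.cong)


section \<open>Matrix factorizations and the pseudoinverse\<close>

text \<open>Reduced, full and intermediate QR factorizations are all allowed. The constant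
  \<^const>\<open>upper_triangular\<close> is not used because it reads entries outside of \<open>R\<close> if \<open>R\<close> has more
  rows than columns.\<close>

definition qr_factorization :: "real mat \<Rightarrow> real mat \<Rightarrow> real mat \<Rightarrow> bool" where
  "qr_factorization A Q R \<longleftrightarrow>
     Q \<in> carrier_mat (dim_row A) (dim_col Q) \<and> R \<in> carrier_mat (dim_col Q) (dim_col A) \<and>
     Q\<^sup>T * Q = 1\<^sub>m (dim_col Q) \<and>
     (\<forall>i < dim_row R. \<forall>j < dim_col R. j < i \<longrightarrow> R $$ (i, j) = 0) \<and>
     A = Q * R"

text \<open>The conditions force the diagonal of \<open>S\<close> to consist of exactly the nonzero singular values
  of \<open>A\<close>, in any order. \<open>S\<close> may be the empty matrix.\<close>

definition compact_svd :: "real mat \<Rightarrow> real mat \<Rightarrow> real mat \<Rightarrow> real mat \<Rightarrow> bool" where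
  "compact_svd A U S V \<longleftrightarrow>
     (let s = dim_row S in
       U \<in> carrier_mat (dim_row A) s \<and> S \<in> carrier_mat s s \<and> V \<in> carrier_mat (dim_col A) s \<and>
       U\<^sup>T * U = 1\<^sub>m s \<and> V\<^sup>T * V = 1\<^sub>m s \<and>
       diagonal_mat S \<and> (\<forall>i < s. S $$ (i, i) > 0) \<and>
       A = U * S * V\<^sup>T)"

definition moore_penrose :: "real mat \<Rightarrow> real mat \<Rightarrow> bool" where
  "moore_penrose A B \<longleftrightarrow>
     B \<in> carrier_mat (dim_col A) (dim_row A) \<and>
     A * B * A = A \<and> B * A * B = B \<and> (A * B)\<^sup>T = A * B \<and> (B * A)\<^sup>T = B * A"

definition pseudoinverse :: "real mat \<Rightarrow> real mat" where
  "pseudoinverse A = (THE B. moore_penrose A B)"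


section \<open>The pseudoinverse procedure\<close>

text \<open>Since the QR factorizations and the SVD are not unique, the procedure is a relation between
  its input and its possible results.\<close>

definition left_step :: "(nat \<Rightarrow> nat) \<Rightarrow> nat \<Rightarrow> cores \<Rightarrow> cores \<Rightarrow> bool" where
  "left_step n \<mu> = (\<lambda>(r, c) T'. \<exists>Q R s y z.
     qr_factorization (unfold_left (r (\<mu>-1)) (n \<mu>) (r \<mu>) (c \<mu>)) Q R \<and> s = dim_col Q \<and>
     unfold_left (r (\<mu>-1)) (n \<mu>) s y = Q \<and>
     unfold_right s (n (\<mu>+1)) (r (\<mu>+1)) z
       = R * unfold_right (r \<mu>) (n (\<mu>+1)) (r (\<mu>+1)) (c (\<mu>+1)) \<and>
     T' = (r(\<mu> := s), c(\<mu> := y, \<mu>+1 := z)))"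

definition right_step :: "(nat \<Rightarrow> nat) \<Rightarrow> nat \<Rightarrow> cores \<Rightarrow> cores \<Rightarrow> bool" where
  "right_step n \<mu> = (\<lambda>(r, c) T'. \<exists>Q R s y z.
     qr_factorization ((unfold_right (r (\<mu>-1)) (n \<mu>) (r \<mu>) (c \<mu>))\<^sup>T) Q R \<and> s = dim_col Q \<and>
     unfold_right s (n \<mu>) (r \<mu>) y = Q\<^sup>T \<and>
     unfold_left (r (\<mu>-2)) (n (\<mu>-1)) s z
       = unfold_left (r (\<mu>-2)) (n (\<mu>-1)) (r (\<mu>-1)) (c (\<mu>-1)) * R\<^sup>T \<and>
     T' = (r(\<mu>-1 := s), c(\<mu> := y, \<mu>-1 := z)))"

fun sweep :: "(nat \<Rightarrow> cores \<Rightarrow> cores \<Rightarrow> bool) \<Rightarrow> nat list \<Rightarrow> cores \<Rightarrow> cores \<Rightarrow> bool" where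
  "sweep step [] T T' \<longleftrightarrow> T' = T"
| "sweep step (\<mu> # \<mu>s) T T' \<longleftrightarrow> (\<exists>T''. step \<mu> T T'' \<and> sweep step \<mu>s T'' T')"

definition left_orthonormalization :: "(nat \<Rightarrow> nat) \<Rightarrow> nat \<Rightarrow> cores \<Rightarrow> cores \<Rightarrow> bool" where
  "left_orthonormalization n p = sweep (left_step n) [1..<p+1]"

definition right_orthonormalization :: "nat \<Rightarrow> (nat \<Rightarrow> nat) \<Rightarrow> nat \<Rightarrow> cores \<Rightarrow> cores \<Rightarrow> bool" where
  "right_orthonormalization d n p = sweep (right_step n) (rev [p..<d+1])"

definition svd_step :: "(nat \<Rightarrow> nat) \<Rightarrow> nat \<Rightarrow> cores \<Rightarrow> cores \<Rightarrow> real mat \<Rightarrow> bool" where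
  "svd_step n l = (\<lambda>(r, c) T' S. \<exists>U V s y z.
     compact_svd (unfold_left (r (l-1)) (n l) (r l) (c l)) U S V \<and> s = dim_row S \<and>
     unfold_left (r (l-1)) (n l) s y = U \<and>
     unfold_right s (n (l+1)) (r (l+1)) z
       = V\<^sup>T * unfold_right (r l) (n (l+1)) (r (l+1)) (c (l+1)) \<and>
     T' = (r(l := s), c(l := y, l+1 := z)))"

definition pseudoinverse_procedure ::
    "nat \<Rightarrow> (nat \<Rightarrow> nat) \<Rightarrow> nat \<Rightarrow> cores \<Rightarrow> real mat \<Rightarrow> real mat \<Rightarrow> real mat \<Rightarrow> bool" where
  "pseudoinverse_procedure d n l T M S N \<longleftrightarrow> (\<exists>T1 T2 T3.
     left_orthonormalization n (l-1) T T1 \<and>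
     right_orthonormalization d n (l+1) T1 T2 \<and>
     svd_step n l T2 T3 S \<and>
     M = left_interface n l T3 \<and>
     N = right_interface d n l T3)"

end

theory Submission
  imports Defs "Jordan_Normal_Form.Determinant"
begin

text \<open>Every orthonormalization step replaces two neighbouring cores by two others with the
  same contraction, so the tensor does not change, and the SVD step turns the splitting of the tensor
  at mode \<open>l\<close> into \<open>X = M * S * N\<close>. The cores \<open>1, \<dots>, l\<close> are left-orthonormal at the end and the cores
  \<open>l + 1, \<dots>, d\<close> are right-orthonormal, the core \<open>l + 1\<close> because \<open>V\<^sup>T\<close> has orthonormal rows. Hence \<open>M\<close>
  has orthonormal columns and \<open>N\<close> has orthonormal rows, and the Penrose conditions for
  \<open>N\<^sup>T * S\<^sup>-\<^sup>1 * M\<^sup>T\<close> follow by cancellation.\<close>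

section \<open>The Moore--Penrose inverse\<close>

text \<open>Symmetry does the work: \<open>A * B = (A * C) * (A * B)\<close>, and transposing swaps
  the two symmetric factors, which yields \<open>A * B = A * C\<close>. In the same way
  \<open>B * A = C * A\<close>, so both inverses equal \<open>C * A * B\<close>.\<close>

lemma moore_penrose_unique:
  assumes "moore_penrose A B" "moore_penrose A C"
  shows "B = C"
proof -
  define m k where "m = dim_row A" and "k = dim_col A"
  have A: "A \<in> carrier_mat m k" and B: "B \<in> carrier_mat k m" and C: "C \<in> carrier_mat k m"
    using assms by (auto simp: moore_penrose_def m_def k_def)
  have b: "A * B * A = A" "B * A * B = B" "(A * B)\<^sup>T = A * B" "(B * A)\<^sup>T = B * A"
    and c: "A * C * A = A" "C * A * C = C" "(A * C)\<^sup>T = A * C" "(C * A)\<^sup>T = C * A"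
    using assms by (auto simp: moore_penrose_def)
  have AB: "A * B \<in> carrier_mat m m" and AC: "A * C \<in> carrier_mat m m"
    and BA: "B * A \<in> carrier_mat k k" and CA: "C * A \<in> carrier_mat k k"
    using A B C by auto
  have "A * B = (A * C * A) * B" using c by simp
  also have "\<dots> = (A * C) * (A * B)" by (rule assoc_mult_mat[OF AC A B])
  finally have 1: "A * B = (A * C) * (A * B)" .
  have "A * B = ((A * C) * (A * B))\<^sup>T" using b(3) 1 by simp
  also have "\<dots> = (A * B) * (A * C)" using transpose_mult[OF AC AB] b c by simp
  also have "\<dots> = (A * B * A) * C" using assoc_mult_mat[OF AB A C] by simp
  finally have AB_eq: "A * B = A * C" using b by simp
  have "B * A = B * (A * C * A)" using c by simp
  also have "\<dots> = (B * A) * (C * A)"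
    using assoc_mult_mat[OF A C A] assoc_mult_mat[OF B A CA] by simp
  finally have 2: "B * A = (B * A) * (C * A)" .
  have "B * A = ((B * A) * (C * A))\<^sup>T" using b(4) 2 by simp
  also have "\<dots> = (C * A) * (B * A)" using transpose_mult[OF BA CA] b c by simp
  also have "\<dots> = C * (A * B * A)"
    using assoc_mult_mat[OF C A BA] assoc_mult_mat[OF A B A] by simp
  finally have BA_eq: "B * A = C * A" using b by simp
  have "B = C * A * B" using b BA_eq by simp
  also have "\<dots> = C * (A * C)" using assoc_mult_mat[OF C A B] AB_eq by simp
  also have "\<dots> = C" using assoc_mult_mat[OF C A C] c by simp
  finally show ?thesis .
qed

lemma pseudoinverse_eqI: "moore_penrose A B \<Longrightarrow> pseudoinverse A = B"
  unfolding pseudoinverse_def by (rule the_equality) (auto intro: moore_penrose_unique)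

text \<open>The determinant is the product of the diagonal entries, so \<open>S\<close> is a unit of
  the matrix ring and \<open>mat_inverse\<close> cannot return \<open>None\<close>. The case
  \<open>s = 0\<close> is covered, the empty product being 1.\<close>

lemma mat_inverse_diagonal:
  fixes S :: "real mat"
  assumes S: "S \<in> carrier_mat s s" and diag: "diagonal_mat S" and nz: "\<And>i. i < s \<Longrightarrow> S $$ (i, i) \<noteq> 0"
  obtains D where "mat_inverse S = Some D" "D \<in> carrier_mat s s" "S * D = 1\<^sub>m s" "D * S = 1\<^sub>m s"
proof -
  have "upper_triangular S"
    using S diag unfolding upper_triangular_def diagonal_mat_def by auto
  then have "det S = prod_list (diag_mat S)"
    using S by (rule det_upper_triangular)
  also have "\<dots> \<noteq> 0"
    using S nz by (auto simp: diag_mat_def prod_list_zero_iff)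
  finally have "S \<in> Units (ring_mat TYPE(real) s ())"
    by (rule det_non_zero_imp_unit[OF S])
  then obtain D where "mat_inverse S = Some D"
    using mat_inverse(1)[OF S, where b = "()"] by (cases "mat_inverse S") auto
  with mat_inverse(2)[OF S this] show ?thesis by (intro that) auto
qed

lemma mult_mat_cancel_left:
  fixes A B X :: "'a::semiring_1 mat"
  assumes "A \<in> carrier_mat s m" "B \<in> carrier_mat m s" "A * B = 1\<^sub>m s" "X \<in> carrier_mat s k"
  shows "A * (B * X) = X"
proof -
  have "A * (B * X) = A * B * X" by (rule assoc_mult_mat[OF assms(1,2,4), symmetric])
  also have "\<dots> = X" unfolding assms(3) by (rule left_mult_one_mat[OF assms(4)])
  finally show ?thesis .
qed

text \<open>The factors between the outer ones cancel, so the two products are the orthogonal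
  projections \<open>M * M\<^sup>T\<close> and \<open>N\<^sup>T * N\<close>. These are symmetric,
  and one more cancellation gives the other two Penrose equations.\<close>

lemma moore_penrose_factorization:
  assumes M: "M \<in> carrier_mat m s" and S: "S \<in> carrier_mat s s" and D: "D \<in> carrier_mat s s"
    and N: "N \<in> carrier_mat s k"
    and MM: "M\<^sup>T * M = 1\<^sub>m s" and NN: "N * N\<^sup>T = 1\<^sub>m s" and SD: "S * D = 1\<^sub>m s" and DS: "D * S = 1\<^sub>m s"
  shows "moore_penrose (M * S * N) (N\<^sup>T * D * M\<^sup>T)"
proof -
  have MT: "M\<^sup>T \<in> carrier_mat s m" and NT: "N\<^sup>T \<in> carrier_mat k s"
    and MS: "M * S \<in> carrier_mat m s" and ND: "N\<^sup>T * D \<in> carrier_mat k s"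
    and DM: "D * M\<^sup>T \<in> carrier_mat s m" and SN: "S * N \<in> carrier_mat s k"
    using M N S D by auto
  let ?A = "M * S * N" and ?B = "N\<^sup>T * D * M\<^sup>T"
  have A: "?A \<in> carrier_mat m k" and B: "?B \<in> carrier_mat k m" using M N S D by auto
  have "?A * ?B = (M * S) * (N * (N\<^sup>T * (D * M\<^sup>T)))"
    using assoc_mult_mat[OF NT D MT] assoc_mult_mat[OF MS N B] by simp
  also have "N * (N\<^sup>T * (D * M\<^sup>T)) = D * M\<^sup>T"
    by (rule mult_mat_cancel_left[OF N NT NN DM])
  also have "(M * S) * (D * M\<^sup>T) = M * M\<^sup>T"
    using assoc_mult_mat[OF M S DM] mult_mat_cancel_left[OF S D SD MT] by simp
  finally have AB: "?A * ?B = M * M\<^sup>T" .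
  have "?B * ?A = (N\<^sup>T * D) * (M\<^sup>T * (M * (S * N)))"
    using assoc_mult_mat[OF M S N] assoc_mult_mat[OF ND MT A] by simp
  also have "M\<^sup>T * (M * (S * N)) = S * N"
    by (rule mult_mat_cancel_left[OF MT M MM SN])
  also have "(N\<^sup>T * D) * (S * N) = N\<^sup>T * N"
    using assoc_mult_mat[OF NT D SN] mult_mat_cancel_left[OF D S DS N] by simp
  finally have BA: "?B * ?A = N\<^sup>T * N" .
  have "M * M\<^sup>T * ?A = M * (M\<^sup>T * (M * (S * N)))"
    using assoc_mult_mat[OF M S N] assoc_mult_mat[OF M MT A] by simp
  also have "M\<^sup>T * (M * (S * N)) = S * N"
    by (rule mult_mat_cancel_left[OF MT M MM SN])
  finally have ABA: "M * M\<^sup>T * ?A = ?A" using assoc_mult_mat[OF M S N] by simp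
  have "N\<^sup>T * N * ?B = N\<^sup>T * (N * (N\<^sup>T * (D * M\<^sup>T)))"
    using assoc_mult_mat[OF NT D MT] assoc_mult_mat[OF NT N B] by simp
  also have "N * (N\<^sup>T * (D * M\<^sup>T)) = D * M\<^sup>T"
    by (rule mult_mat_cancel_left[OF N NT NN DM])
  finally have BAB: "N\<^sup>T * N * ?B = ?B" using assoc_mult_mat[OF NT D MT] by simp
  show ?thesis
    unfolding moore_penrose_def AB BA ABA BAB
    using A B transpose_mult[OF M MT] transpose_mult[OF NT N] by auto
qed


section \<open>Partial products of a TT-format\<close>

text \<open>The all-ones row vector of length \<open>r 0\<close> times the slices
  \<open>c 1\<close>, ..., \<open>c m\<close> at \<open>i\<close>. The recursive form supports
  induction over the cores, in contrast to the sum over all rank indices at once.\<close>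

primrec left_part :: "(nat \<Rightarrow> nat) \<Rightarrow> (nat \<Rightarrow> core) \<Rightarrow> (nat \<Rightarrow> nat) \<Rightarrow> nat \<Rightarrow> nat \<Rightarrow> real" where
  "left_part r c i 0 k = 1"
| "left_part r c i (Suc m) k = (\<Sum>a<r m. left_part r c i m a * c (Suc m) a (i (Suc m)) k)"

text \<open>\<open>right_part r c i t m\<close> is the product of the \<open>t\<close> cores \<open>m + 1, \<dots>, m + t\<close>.\<close>

primrec right_part ::
    "(nat \<Rightarrow> nat) \<Rightarrow> (nat \<Rightarrow> core) \<Rightarrow> (nat \<Rightarrow> nat) \<Rightarrow> nat \<Rightarrow> nat \<Rightarrow> nat \<Rightarrow> real" where
  "right_part r c i 0 m k = 1"
| "right_part r c i (Suc t) m k =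
     (\<Sum>b<r (Suc m). c (Suc m) k (i (Suc m)) b * right_part r c i t (Suc m) b)"

text \<open>The last rank index is summed as well, so that this equals the full sum over
  \<open>k\<close> in the TT-format for every value of \<open>r 0\<close> and
  \<open>r d\<close>.\<close>

definition tt_entry :: "nat \<Rightarrow> (nat \<Rightarrow> nat) \<Rightarrow> (nat \<Rightarrow> core) \<Rightarrow> (nat \<Rightarrow> nat) \<Rightarrow> real" where
  "tt_entry d r c i = (\<Sum>k<r d. left_part r c i d k)"

lemma left_part_cong:
  assumes "\<And>\<nu>. \<nu> < m \<Longrightarrow> r \<nu> = r' \<nu>"
    and "\<And>\<nu>. 1 \<le> \<nu> \<Longrightarrow> \<nu> \<le> m \<Longrightarrow> c \<nu> = c' \<nu> \<and> i \<nu> = i' \<nu>"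
  shows "left_part r c i m k = left_part r' c' i' m k"
  using assms by (induction m arbitrary: k) auto

lemma right_part_cong:
  assumes "\<And>\<nu>. m < \<nu> \<Longrightarrow> \<nu> \<le> m + t \<Longrightarrow> r \<nu> = r' \<nu> \<and> c \<nu> = c' \<nu> \<and> i \<nu> = i' \<nu>"
  shows "right_part r c i t m k = right_part r' c' i' t m k"
  using assms by (induction t arbitrary: m k) auto

text \<open>Fubini for a dependent product. It peels off one rank index at a time from the sums in
  the TT-format and the interface matrices.\<close>

lemma sum_PiE_insert:
  fixes f :: "('a \<Rightarrow> 'b) \<Rightarrow> 'c::comm_monoid_add"
  assumes "x \<notin> A"
  shows "sum f (PiE (insert x A) T) = (\<Sum>y\<in>T x. \<Sum>g\<in>PiE A T. f (g(x := y)))"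
proof -
  have "sum f (PiE (insert x A) T) = (\<Sum>(y, g)\<in>T x \<times> PiE A T. f (g(x := y)))"
    unfolding PiE_insert_eq
    by (subst sum.reindex[OF inj_combinator[OF assms]]) (simp add: case_prod_unfold)
  then show ?thesis by (simp add: sum.cartesian_product)
qed

lemma sum_core_prod_left:
  "(\<Sum>k \<in> (\<Pi>\<^sub>E \<mu>\<in>{0..<m}. {..<r \<mu>}). core_prod c 1 m i (k(m := kl))) = left_part r c i m kl"
proof (induction m arbitrary: kl)
  case 0
  then show ?case by (simp add: core_prod_def)
next
  case (Suc m)
  \<comment> \<open>Once position \<open>m\<close> is fixed to \<open>a\<close>, it takes the role
    of \<open>kl\<close> for the shorter product; cores up to \<open>m\<close> never read position
    \<open>m + 1\<close>.\<close>
  have "core_prod c 1 (Suc m) i (g(m := a, Suc m := kl)) =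
      core_prod c 1 m i (g(m := a)) * c (Suc m) a (i (Suc m)) kl" for g a
    unfolding core_prod_def by (auto intro!: prod.cong)
  then show ?case
    by (simp only: atLeast0_lessThan_Suc sum_PiE_insert[of m "{0..<m}"] atLeastLessThan_iff
        less_irrefl simp_thms not_False_eq_True Suc.IH left_part.simps flip: sum_distrib_right)
qed

lemma sum_core_prod_right:
  "(\<Sum>k \<in> (\<Pi>\<^sub>E \<mu>\<in>{Suc m..m + t}. {..<r \<mu>}). core_prod c (Suc m) (m + t) i (k(m := kl)))
    = right_part r c i t m kl"
proof (induction t arbitrary: m kl)
  case 0
  then show ?case by (simp add: core_prod_def)
next
  case (Suc t)
  have set: "{Suc m..m + Suc t} = insert (Suc m) {Suc (Suc m)..Suc m + t}" by auto
  \<comment> \<open>Only core \<open>m + 1\<close> reads position \<open>m\<close>. The later cores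
    start from position \<open>m + 1\<close>, where \<open>b\<close> now plays the role of
    \<open>kl\<close>.\<close>
  have "core_prod c (Suc m) (m + Suc t) i (g(Suc m := b, m := kl)) =
      c (Suc m) kl (i (Suc m)) b * core_prod c (Suc (Suc m)) (Suc m + t) i (g(Suc m := b))" for g b
    unfolding core_prod_def set by (auto intro!: prod.cong)
  moreover have "Suc m \<notin> {Suc (Suc m)..Suc m + t}" by simp
  ultimately show ?case
    unfolding set
    by (simp only: sum_PiE_insert not_False_eq_True right_part.simps Suc.IH flip: sum_distrib_left)
qed

lemma tt_format_entry:
  assumes "tt_format d n (r, c) x" and "i \<in> (\<Pi>\<^sub>E \<mu>\<in>{1..d}. {..<n \<mu>})"
  shows "x i = tt_entry d r c i"
proof -
  have "{0..d} = insert d {0..<d}" by auto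
  then show ?thesis
    using assms
    by (simp only: tt_format_def prod.case sum_PiE_insert[of d "{0..<d}"] atLeastLessThan_iff
        less_irrefl simp_thms sum_core_prod_left tt_entry_def not_False_eq_True)
qed

text \<open>Associativity of the slice product: the cut moves one core to the right by exchanging
  two sums, until no core remains on the right.\<close>

lemma tt_entry_split:
  "(\<Sum>k<r m. left_part r c i m k * right_part r c i t m k) = tt_entry (m + t) r c i"
proof (induction t arbitrary: m)
  case 0
  then show ?case by (simp add: tt_entry_def)
next
  case (Suc t)
  have "(\<Sum>k<r m. left_part r c i m k * right_part r c i (Suc t) m k) =
      (\<Sum>k<r m. \<Sum>b<r (Suc m). left_part r c i m k * c (Suc m) k (i (Suc m)) b
        * right_part r c i t (Suc m) b)"
    by (simp add: sum_distrib_left mult.assoc)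
  also have "\<dots> = (\<Sum>b<r (Suc m). left_part r c i (Suc m) b * right_part r c i t (Suc m) b)"
    by (subst sum.swap) (simp add: sum_distrib_right)
  finally show ?case using Suc.IH[of "Suc m"] by simp
qed

text \<open>Beyond both cores only their contraction over the shared rank enters. The bounds on
  \<open>i\<close> and \<open>k\<close> matter because the contractions are known to agree only
  within the core sizes.\<close>

lemma left_part_replace_pair:
  fixes r n :: "nat \<Rightarrow> nat" and y z :: core
  assumes pair: "\<And>a j j' b. a < r m \<Longrightarrow> j < n (Suc m) \<Longrightarrow> j' < n (Suc (Suc m)) \<Longrightarrow>
      b < r (Suc (Suc m)) \<Longrightarrow>
      (\<Sum>e<s. y a j e * z e j' b) = (\<Sum>k<r (Suc m). c (Suc m) a j k * c (Suc (Suc m)) k j' b)"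
    and i: "i (Suc m) < n (Suc m)" "i (Suc (Suc m)) < n (Suc (Suc m))"
    and "Suc (Suc m) \<le> q" and "k < r q"
  shows "left_part (r(Suc m := s)) (c(Suc m := y, Suc (Suc m) := z)) i q k = left_part r c i q k"
  using assms(4,5)
proof (induction q arbitrary: k rule: dec_induct)
  case base
  let ?r = "r(Suc m := s)" and ?c = "c(Suc m := y, Suc (Suc m) := z)"
  \<comment> \<open>Neither the rank \<open>m + 1\<close> nor the two replaced cores are read up to
    core \<open>m\<close>.\<close>
  have lp: "left_part ?r ?c i m a = left_part r c i m a" for a
    by (rule left_part_cong) auto
  have "left_part ?r ?c i (Suc (Suc m)) k =
      (\<Sum>a<r m. left_part r c i m a * (\<Sum>e<s. y a (i (Suc m)) e * z e (i (Suc (Suc m))) k))"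
    by (simp add: lp sum_distrib_right sum_distrib_left mult.assoc) (rule sum.swap)
  also have "\<dots> = (\<Sum>a<r m. left_part r c i m a *
      (\<Sum>e<r (Suc m). c (Suc m) a (i (Suc m)) e * c (Suc (Suc m)) e (i (Suc (Suc m))) k))"
    using i base by (intro sum.cong refl arg_cong2[of _ _ _ _ "(*)"] pair) auto
  also have "\<dots> = left_part r c i (Suc (Suc m)) k"
    by (simp add: sum_distrib_right sum_distrib_left mult.assoc) (rule sum.swap)
  finally show ?case .
next
  case (step q)
  then show ?case by (auto intro!: sum.cong)
qed

text \<open>The bridge from matrix identities between unfoldings to contractions of neighbouring
  cores.\<close>

lemma unfold_mult_index:
  assumes "a < r" "j < n" "j' < n'" "b < r'"
  shows "(unfold_left r n s y * unfold_right s n' r' z) $$ (a + j * r, j' + b * n')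
    = (\<Sum>e<s. y a j e * z e j' b)"
  using assms pair_index_less[OF assms(1,2)] pair_index_less[OF assms(3,4)]
  by (simp add: unfold_left_def unfold_right_def scalar_prod_def lessThan_atLeast0)

text \<open>The common invariance argument for both kinds of QR steps and for the SVD step with
  \<open>S\<close> multiplied back: each preserves the product of two neighbouring
  unfoldings.\<close>

lemma tt_entry_replace_pair:
  fixes r n :: "nat \<Rightarrow> nat" and y z :: core
  assumes eq: "unfold_left (r m) (n (Suc m)) s y * unfold_right s (n (Suc (Suc m))) (r (Suc (Suc m))) z
      = unfold_left (r m) (n (Suc m)) (r (Suc m)) (c (Suc m))
        * unfold_right (r (Suc m)) (n (Suc (Suc m))) (r (Suc (Suc m))) (c (Suc (Suc m)))"
    and i: "\<And>\<mu>. 1 \<le> \<mu> \<Longrightarrow> \<mu> \<le> d \<Longrightarrow> i \<mu> < n \<mu>" and "Suc (Suc m) \<le> d"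
  shows "tt_entry d (r(Suc m := s)) (c(Suc m := y, Suc (Suc m) := z)) i = tt_entry d r c i"
proof -
  have "left_part (r(Suc m := s)) (c(Suc m := y, Suc (Suc m) := z)) i d k = left_part r c i d k"
    if "k < r d" for k
  proof (rule left_part_replace_pair[where n = n])
    fix a j j' b
    assume "a < r m" "j < n (Suc m)" "j' < n (Suc (Suc m))" "b < r (Suc (Suc m))"
    then show "(\<Sum>e<s. y a j e * z e j' b) =
        (\<Sum>k<r (Suc m). c (Suc m) a j k * c (Suc (Suc m)) k j' b)"
      using arg_cong[OF eq, of "\<lambda>A. A $$ (a + j * r m, j' + b * n (Suc (Suc m)))"]
      by (simp only: unfold_mult_index)
  qed (use i \<open>Suc (Suc m) \<le> d\<close> that in auto)
  then show ?thesis using \<open>Suc (Suc m) \<le> d\<close> by (auto simp: tt_entry_def)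
qed


section \<open>Orthonormal cores and interface matrices\<close>

text \<open>Orthonormal columns of the left unfolding, as double sums in the shape that
  \<open>gram_compose\<close> consumes; \<open>left_orth_iff\<close> gives the matrix form.\<close>

definition left_orth :: "(nat \<Rightarrow> nat) \<Rightarrow> (nat \<Rightarrow> nat) \<Rightarrow> (nat \<Rightarrow> core) \<Rightarrow> nat \<Rightarrow> bool" where
  "left_orth n r c \<mu> \<longleftrightarrow> (\<forall>k<r \<mu>. \<forall>k'<r \<mu>.
     (\<Sum>j<n \<mu>. \<Sum>a<r (\<mu>-1). c \<mu> a j k * c \<mu> a j k') = of_bool (k = k'))"

definition right_orth :: "(nat \<Rightarrow> nat) \<Rightarrow> (nat \<Rightarrow> nat) \<Rightarrow> (nat \<Rightarrow> core) \<Rightarrow> nat \<Rightarrow> bool" where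
  "right_orth n r c \<mu> \<longleftrightarrow> (\<forall>a<r (\<mu>-1). \<forall>a'<r (\<mu>-1).
     (\<Sum>j<n \<mu>. \<Sum>b<r \<mu>. c \<mu> a j b * c \<mu> a' j b) = of_bool (a = a'))"

text \<open>A little-endian index range falls into \<open>n\<close> blocks of length
  \<open>P\<close>, with \<open>j\<close> numbering the blocks. This serves both unfolding indices
  and multi-indices.\<close>

lemma sum_mixed_radix:
  fixes f :: "nat \<Rightarrow> 'a::comm_monoid_add"
  shows "(\<Sum>p<P * n. f p) = (\<Sum>j<n. \<Sum>p<P. f (p + j * P))"
proof -
  have "(\<Sum>p<P * n. f p) = (\<Sum>j<n. sum f {j * P..<j * P + P})"
    by (simp add: sum.nat_group mult.commute)
  moreover have "sum f {j * P..<j * P + P} = (\<Sum>p<P. f (p + j * P))" for j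
    using sum.shift_bounds_nat_ivl[of f 0 "j * P" P] by (simp add: lessThan_atLeast0 add.commute)
  ultimately show ?thesis by simp
qed

text \<open>Composing with an orthonormal system preserves inner products. This is the induction
  step for the Gram matrices of left and right parts.\<close>

lemma gram_compose:
  fixes C :: "'k \<Rightarrow> 'j \<Rightarrow> nat \<Rightarrow> real" and g :: "'q \<Rightarrow> nat \<Rightarrow> real"
  assumes g: "\<And>b b'. b < s \<Longrightarrow> b' < s \<Longrightarrow> (\<Sum>q\<in>B. g q b * g q b') = of_bool (b = b')"
    and C: "(\<Sum>j\<in>J. \<Sum>b<s. C k j b * C k' j b) = w"
  shows "(\<Sum>j\<in>J. \<Sum>q\<in>B. (\<Sum>b<s. C k j b * g q b) * (\<Sum>b<s. C k' j b * g q b)) = w"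
proof -
  have "(\<Sum>q\<in>B. (\<Sum>b<s. C k j b * g q b) * (\<Sum>b<s. C k' j b * g q b)) =
      (\<Sum>b<s. C k j b * C k' j b)" for j
  proof -
    have "(\<Sum>q\<in>B. (\<Sum>b<s. C k j b * g q b) * (\<Sum>b<s. C k' j b * g q b)) =
        (\<Sum>q\<in>B. \<Sum>b<s. \<Sum>b'<s. C k j b * C k' j b' * (g q b * g q b'))"
      by (simp add: sum_product ac_simps)
    also have "\<dots> = (\<Sum>b<s. \<Sum>b'<s. \<Sum>q\<in>B. C k j b * C k' j b' * (g q b * g q b'))"
      by (subst sum.swap, rule sum.cong[OF refl], rule sum.swap)
    also have "\<dots> = (\<Sum>b<s. \<Sum>b'<s. C k j b * C k' j b' * of_bool (b = b'))"
      by (simp add: g flip: sum_distrib_left)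
    also have "\<dots> = (\<Sum>b<s. C k j b * C k' j b)"
      by (intro sum.cong refl) (simp add: of_bool_def if_distrib cong: if_cong)
    finally show ?thesis .
  qed
  then show ?thesis using C by simp
qed

text \<open>Induction over the cores: mode \<open>m + 1\<close> is the most significant digit of the
  row index, so the sum splits into blocks and \<open>gram_compose\<close> applies. In the base case
  \<open>r 0 = 1\<close> leaves only \<open>k = k' = 0\<close>.\<close>

lemma left_part_gram:
  assumes "\<And>\<mu>. 1 \<le> \<mu> \<Longrightarrow> \<mu> \<le> m \<Longrightarrow> left_orth n r c \<mu>" and "r 0 = 1"
    and "k < r m" "k' < r m"
  shows "(\<Sum>p<(\<Prod>\<mu>=1..m. n \<mu>). left_part r c (mdigit n 1 p) m k * left_part r c (mdigit n 1 p) m k')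
    = of_bool (k = k')"
  using assms
proof (induction m arbitrary: k k')
  case 0
  then show ?case by simp
next
  case (Suc m)
  define P where "P = (\<Prod>\<mu>=1..m. n \<mu>)"
  have P_Suc: "(\<Prod>\<mu>=1..Suc m. n \<mu>) = P * n (Suc m)" by (simp add: P_def mult.commute)
  have lp: "left_part r c (mdigit n 1 (p + j * P)) (Suc m) e =
      (\<Sum>a<r m. c (Suc m) a j e * left_part r c (mdigit n 1 p) m a)"
    if "p < P" "j < n (Suc m)" for p j e
  proof -
    have "(p + j * P) div P = j" using that by simp
    then have "mdigit n 1 (p + j * P) (Suc m) = j"
      using that by (simp add: mdigit_def P_def atLeastLessThanSuc_atLeastAtMost)
    \<comment> \<open>Lower digits do not see the summand \<open>j * P\<close>: \<open>P\<close> is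
      a multiple of the place value of mode \<open>\<mu>\<close> times \<open>n \<mu>\<close>, so
      \<open>mod\<close> removes it.\<close>
    moreover have "mdigit n 1 (p + j * P) \<mu> = mdigit n 1 p \<mu>" if \<mu>: "1 \<le> \<mu>" "\<mu> \<le> m" for \<mu>
    proof -
      have "{1..m} = {1..<\<mu>} \<union> {\<mu>..m}" "{1..<\<mu>} \<inter> {\<mu>..m} = {}" using \<mu> by auto
      then have "P = (\<Prod>\<nu>=1..<\<mu>. n \<nu>) * (n \<mu> * (\<Prod>\<nu>=Suc \<mu>..m. n \<nu>))"
        unfolding P_def using \<mu> by (simp add: prod.union_disjoint prod.atLeast_Suc_atMost)
      then obtain u where u: "P = (\<Prod>\<nu>=1..<\<mu>. n \<nu>) * (n \<mu> * u)" by blast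
      moreover have "P > 0" using \<open>p < P\<close> by simp
      ultimately have "(\<Prod>\<nu>=1..<\<mu>. n \<nu>) > 0" by simp
      then have "(p + j * P) div (\<Prod>\<nu>=1..<\<mu>. n \<nu>) = p div (\<Prod>\<nu>=1..<\<mu>. n \<nu>) + n \<mu> * (j * u)"
        unfolding u using div_mult_self2[of "\<Prod>\<nu>=1..<\<mu>. n \<nu>" p "n \<mu> * (j * u)"]
        by (simp add: ac_simps)
      then show ?thesis by (simp add: mdigit_def)
    qed
    then have "left_part r c (mdigit n 1 (p + j * P)) m a = left_part r c (mdigit n 1 p) m a" for a
      by (intro left_part_cong) auto
    ultimately show ?thesis by (simp add: mult.commute)
  qed
  have "(\<Sum>p<P * n (Suc m). left_part r c (mdigit n 1 p) (Suc m) k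
        * left_part r c (mdigit n 1 p) (Suc m) k') =
      (\<Sum>j<n (Suc m). \<Sum>p<P.
        (\<Sum>a<r m. c (Suc m) a j k * left_part r c (mdigit n 1 p) m a)
      * (\<Sum>a<r m. c (Suc m) a j k' * left_part r c (mdigit n 1 p) m a))"
    unfolding sum_mixed_radix by (intro sum.cong refl) (simp only: lp lessThan_iff)
  also have "\<dots> = of_bool (k = k')"
    using Suc.prems(1)[of "Suc m"] Suc.prems(3,4)
    by (intro gram_compose[where C = "\<lambda>k j a. c (Suc m) a j k"] Suc.IH[folded P_def] Suc.prems)
      (auto simp: left_orth_def)
  finally show ?case unfolding P_Suc .
qed

text \<open>The mirror image, with the induction adding cores in front. Mode \<open>m + 1\<close> is
  now the least significant digit, so the index has the form
  \<open>j + q * n (Suc m)\<close>.\<close>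

lemma right_part_gram:
  assumes "\<And>\<mu>. m < \<mu> \<Longrightarrow> \<mu> \<le> m + t \<Longrightarrow> right_orth n r c \<mu>" and "r (m + t) = 1"
    and "k < r m" "k' < r m"
  shows "(\<Sum>q<(\<Prod>\<mu>=Suc m..m + t. n \<mu>). right_part r c (mdigit n (Suc m) q) t m k
      * right_part r c (mdigit n (Suc m) q) t m k') = of_bool (k = k')"
  using assms
proof (induction t arbitrary: m k k')
  case 0
  then show ?case by simp
next
  case (Suc t)
  define P where "P = (\<Prod>\<mu>=Suc (Suc m)..Suc m + t. n \<mu>)"
  have P_Suc: "(\<Prod>\<mu>=Suc m..m + Suc t. n \<mu>) = n (Suc m) * P"
    unfolding P_def by (simp add: prod.atLeast_Suc_atMost)
  have rp: "right_part r c (mdigit n (Suc m) (j + q * n (Suc m))) (Suc t) m e =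
      (\<Sum>b<r (Suc m). c (Suc m) e j b * right_part r c (mdigit n (Suc (Suc m)) q) t (Suc m) b)"
    if "q < P" "j < n (Suc m)" for q j e
  proof -
    have "mdigit n (Suc m) (j + q * n (Suc m)) (Suc m) = j"
      using that by (simp add: mdigit_def)
    \<comment> \<open>Division by \<open>n (Suc m)\<close> drops the lowest digit and turns an index
      with first mode \<open>m + 1\<close> into one with first mode \<open>m + 2\<close>.\<close>
    moreover have "mdigit n (Suc m) (j + q * n (Suc m)) \<mu> = mdigit n (Suc (Suc m)) q \<mu>"
      if \<mu>: "Suc m < \<mu>" for \<mu>
    proof -
      have "(\<Prod>\<nu>=Suc m..<\<mu>. n \<nu>) = n (Suc m) * (\<Prod>\<nu>=Suc (Suc m)..<\<mu>. n \<nu>)"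
        using \<mu> by (simp add: prod.atLeast_Suc_lessThan)
      then show ?thesis using \<open>j < n (Suc m)\<close> by (simp add: mdigit_def div_mult2_eq)
    qed
    then have "right_part r c (mdigit n (Suc m) (j + q * n (Suc m))) t (Suc m) b =
        right_part r c (mdigit n (Suc (Suc m)) q) t (Suc m) b" for b
      by (intro right_part_cong) auto
    ultimately show ?thesis by simp
  qed
  have "(\<Sum>q<n (Suc m) * P. right_part r c (mdigit n (Suc m) q) (Suc t) m k
        * right_part r c (mdigit n (Suc m) q) (Suc t) m k') =
      (\<Sum>q<P. \<Sum>j<n (Suc m).
        (\<Sum>b<r (Suc m). c (Suc m) k j b * right_part r c (mdigit n (Suc (Suc m)) q) t (Suc m) b)
      * (\<Sum>b<r (Suc m). c (Suc m) k' j b * right_part r c (mdigit n (Suc (Suc m)) q) t (Suc m) b))"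
    unfolding sum_mixed_radix by (intro sum.cong refl) (simp only: rp lessThan_iff)
  also have "\<dots> = of_bool (k = k')"
    \<comment> \<open>The digit \<open>j\<close> of the new core is the inner summation index here;
      the sums are exchanged to fit \<open>gram_compose\<close>.\<close>
    using Suc.prems(1)[of "Suc m"] Suc.prems(2-4)
    by (subst sum.swap, intro gram_compose[where C = "\<lambda>k. c (Suc m) k"]
        Suc.IH[of "Suc m", folded P_def] Suc.prems)
      (auto simp: right_orth_def)
  finally show ?case unfolding P_Suc .
qed

section \<open>Orthonormality of cores in terms of their unfoldings\<close>

lemma left_orth_iff:
  "left_orth n r c \<mu> \<longleftrightarrow>
    (unfold_left (r (\<mu>-1)) (n \<mu>) (r \<mu>) (c \<mu>))\<^sup>T * unfold_left (r (\<mu>-1)) (n \<mu>) (r \<mu>) (c \<mu>) = 1\<^sub>m (r \<mu>)"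
proof -
  let ?L = "unfold_left (r (\<mu>-1)) (n \<mu>) (r \<mu>) (c \<mu>)"
  have "(?L\<^sup>T * ?L) $$ (k, k') = (\<Sum>j<n \<mu>. \<Sum>a<r (\<mu>-1). c \<mu> a j k * c \<mu> a j k')"
    if "k < r \<mu>" "k' < r \<mu>" for k k'
  proof -
    have "(?L\<^sup>T * ?L) $$ (k, k') = (\<Sum>p<r (\<mu>-1) * n \<mu>.
        c \<mu> (p mod r (\<mu>-1)) (p div r (\<mu>-1)) k * c \<mu> (p mod r (\<mu>-1)) (p div r (\<mu>-1)) k')"
      using that by (simp add: unfold_left_def scalar_prod_def lessThan_atLeast0)
    then show ?thesis by (simp add: sum_mixed_radix)
  qed
  moreover have "dim_row (?L\<^sup>T * ?L) = r \<mu>" "dim_col (?L\<^sup>T * ?L) = r \<mu>"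
    by (simp_all add: unfold_left_def)
  ultimately show ?thesis
    unfolding left_orth_def mat_eq_iff by (auto simp del: index_mult_mat)
qed

lemma right_orth_iff:
  "right_orth n r c \<mu> \<longleftrightarrow>
    unfold_right (r (\<mu>-1)) (n \<mu>) (r \<mu>) (c \<mu>) * (unfold_right (r (\<mu>-1)) (n \<mu>) (r \<mu>) (c \<mu>))\<^sup>T
      = 1\<^sub>m (r (\<mu>-1))"
proof -
  let ?R = "unfold_right (r (\<mu>-1)) (n \<mu>) (r \<mu>) (c \<mu>)"
  have "(?R * ?R\<^sup>T) $$ (a, a') = (\<Sum>j<n \<mu>. \<Sum>b<r \<mu>. c \<mu> a j b * c \<mu> a' j b)"
    if "a < r (\<mu>-1)" "a' < r (\<mu>-1)" for a a'
  proof -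
    have "(?R * ?R\<^sup>T) $$ (a, a') = (\<Sum>q<n \<mu> * r \<mu>.
        c \<mu> a (q mod n \<mu>) (q div n \<mu>) * c \<mu> a' (q mod n \<mu>) (q div n \<mu>))"
      using that by (simp add: unfold_right_def scalar_prod_def lessThan_atLeast0)
    then show ?thesis by (simp add: sum_mixed_radix) (rule sum.swap)
  qed
  moreover have "dim_row (?R * ?R\<^sup>T) = r (\<mu>-1)" "dim_col (?R * ?R\<^sup>T) = r (\<mu>-1)"
    by (simp_all add: unfold_right_def)
  ultimately show ?thesis
    unfolding right_orth_def mat_eq_iff by (auto simp del: index_mult_mat)
qed

lemma unfold_left_carrier [simp]: "unfold_left r n r' c \<in> carrier_mat (r * n) r'"
  by (simp add: unfold_left_def)

lemma unfold_right_carrier [simp]: "unfold_right r n r' c \<in> carrier_mat r (n * r')"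
  by (simp add: unfold_right_def)

lemma left_orth_cong:
  "r \<mu> = r' \<mu> \<Longrightarrow> r (\<mu>-1) = r' (\<mu>-1) \<Longrightarrow> c \<mu> = c' \<mu> \<Longrightarrow> left_orth n r c \<mu> \<longleftrightarrow> left_orth n r' c' \<mu>"
  by (simp add: left_orth_def)

lemma right_orth_cong:
  "r \<mu> = r' \<mu> \<Longrightarrow> r (\<mu>-1) = r' (\<mu>-1) \<Longrightarrow> c \<mu> = c' \<mu> \<Longrightarrow> right_orth n r c \<mu> \<longleftrightarrow> right_orth n r' c' \<mu>"
  by (simp add: right_orth_def)


section \<open>The steps of the procedure\<close>

text \<open>Reassociating \<open>Q * (R * C)\<close> to \<open>(Q * R) * C\<close> shows that the
  contraction is kept. Writing the mode as \<open>Suc m\<close> avoids the subtraction in the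
  ranks.\<close>

lemma left_stepE:
  assumes "left_step n (Suc m) (r, c) (r', c')"
  obtains s y z where "r' = r(Suc m := s)" "c' = c(Suc m := y, Suc (Suc m) := z)"
    "left_orth n r' c' (Suc m)"
    "unfold_left (r m) (n (Suc m)) s y * unfold_right s (n (Suc (Suc m))) (r (Suc (Suc m))) z
      = unfold_left (r m) (n (Suc m)) (r (Suc m)) (c (Suc m))
        * unfold_right (r (Suc m)) (n (Suc (Suc m))) (r (Suc (Suc m))) (c (Suc (Suc m)))"
proof -
  let ?A = "unfold_left (r m) (n (Suc m)) (r (Suc m)) (c (Suc m))"
  let ?C = "unfold_right (r (Suc m)) (n (Suc (Suc m))) (r (Suc (Suc m))) (c (Suc (Suc m)))"
  from assms obtain Q R s y z where qr: "qr_factorization ?A Q R" and s: "s = dim_col Q"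
    and y: "unfold_left (r m) (n (Suc m)) s y = Q"
    and z: "unfold_right s (n (Suc (Suc m))) (r (Suc (Suc m))) z = R * ?C"
    and T': "r' = r(Suc m := s)" "c' = c(Suc m := y, Suc (Suc m) := z)"
    unfolding left_step_def by auto
  have Q: "Q \<in> carrier_mat (r m * n (Suc m)) s" and R: "R \<in> carrier_mat s (r (Suc m))"
    and QQ: "Q\<^sup>T * Q = 1\<^sub>m s" and A: "?A = Q * R"
    using qr s by (auto simp: qr_factorization_def unfold_left_def)
  have "Q * (R * ?C) = ?A * ?C"
    unfolding A using assoc_mult_mat[OF Q R unfold_right_carrier] by simp
  moreover have "left_orth n r' c' (Suc m)"
    using QQ y by (simp add: left_orth_iff T')
  ultimately show ?thesis using that[OF T'] y z by simp
qed

lemma right_stepE: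
  assumes "right_step n (Suc (Suc m)) (r, c) (r', c')"
  obtains s y z where "r' = r(Suc m := s)" "c' = c(Suc m := y, Suc (Suc m) := z)"
    "right_orth n r' c' (Suc (Suc m))"
    "unfold_left (r m) (n (Suc m)) s y * unfold_right s (n (Suc (Suc m))) (r (Suc (Suc m))) z
      = unfold_left (r m) (n (Suc m)) (r (Suc m)) (c (Suc m))
        * unfold_right (r (Suc m)) (n (Suc (Suc m))) (r (Suc (Suc m))) (c (Suc (Suc m)))"
proof -
  let ?C = "unfold_left (r m) (n (Suc m)) (r (Suc m)) (c (Suc m))"
  let ?A = "unfold_right (r (Suc m)) (n (Suc (Suc m))) (r (Suc (Suc m))) (c (Suc (Suc m)))"
  from assms obtain Q R s y z where qr: "qr_factorization (?A\<^sup>T) Q R" and s: "s = dim_col Q"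
    and z: "unfold_right s (n (Suc (Suc m))) (r (Suc (Suc m))) z = Q\<^sup>T"
    and y: "unfold_left (r m) (n (Suc m)) s y = ?C * R\<^sup>T"
    and T': "r' = r(Suc m := s)" "c' = c(Suc m := y, Suc (Suc m) := z)"
    \<comment> \<open>The step updates core \<open>\<mu>\<close> before core \<open>\<mu>-1\<close>;
      \<open>fun_upd_twist\<close> brings the updates into the order of the left step.\<close>
    unfolding right_step_def by (auto simp: fun_upd_twist)
  have Q: "Q \<in> carrier_mat (n (Suc (Suc m)) * r (Suc (Suc m))) s"
    and R: "R \<in> carrier_mat s (r (Suc m))"
    and QQ: "Q\<^sup>T * Q = 1\<^sub>m s" and AT: "?A\<^sup>T = Q * R"
    using qr s by (auto simp: qr_factorization_def unfold_right_def)
  have "?A = R\<^sup>T * Q\<^sup>T"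
    using arg_cong[OF AT, of transpose_mat] transpose_mult[OF Q R] by simp
  then have "(?C * R\<^sup>T) * Q\<^sup>T = ?C * ?A"
    using assoc_mult_mat[OF unfold_left_carrier, of "R\<^sup>T" _ _ "Q\<^sup>T"] Q R by simp
  moreover have "right_orth n r' c' (Suc (Suc m))"
    using QQ z by (simp add: right_orth_iff T')
  ultimately show ?thesis using that[OF T'] y z by simp
qed

text \<open>\<open>sweep\<close> unfolds from the front, whereas the invariants are proved by adding
  a last step.\<close>

lemma sweep_snoc:
  "sweep step (\<mu>s @ [\<mu>]) T T' \<longleftrightarrow> (\<exists>T''. sweep step \<mu>s T T'' \<and> step \<mu> T'' T')"
  by (induction \<mu>s arbitrary: T) (simp_all del: split_paired_Ex, blast)

text \<open>Step \<open>p + 1\<close> changes only rank \<open>p + 1\<close> and cores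
  \<open>p + 1\<close> and \<open>p + 2\<close>, so the orthonormality reached earlier survives. The
  unchanged ranks include both boundary ranks 0 and \<open>d\<close>.\<close>

lemma left_orthonormalization_invariants:
  assumes "left_orthonormalization n p (r, c) (r', c')" and "Suc p \<le> d"
  shows "(\<forall>\<nu>. \<nu> = 0 \<or> p < \<nu> \<longrightarrow> r' \<nu> = r \<nu>) \<and> (\<forall>\<mu>\<in>{1..p}. left_orth n r' c' \<mu>) \<and>
    (\<forall>i. (\<forall>\<mu>\<in>{1..d}. i \<mu> < n \<mu>) \<longrightarrow> tt_entry d r' c' i = tt_entry d r c i)"
  using assms
proof (induction p arbitrary: r' c')
  case 0
  then show ?case by (simp add: left_orthonormalization_def)
next
  case (Suc p)
  have "[1..<Suc p + 1] = [1..<p + 1] @ [Suc p]" by simp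
  with Suc.prems(1) obtain r1 c1 where 1: "left_orthonormalization n p (r, c) (r1, c1)"
    and 2: "left_step n (Suc p) (r1, c1) (r', c')"
    unfolding left_orthonormalization_def by (auto simp only: sweep_snoc split_paired_Ex)
  note IH = Suc.IH[OF 1 Suc_leD[OF Suc.prems(2)]]
  from 2 obtain s y z where r': "r' = r1(Suc p := s)" and c': "c' = c1(Suc p := y, Suc (Suc p) := z)"
    and orth: "left_orth n r' c' (Suc p)"
    and eq: "unfold_left (r1 p) (n (Suc p)) s y
        * unfold_right s (n (Suc (Suc p))) (r1 (Suc (Suc p))) z
      = unfold_left (r1 p) (n (Suc p)) (r1 (Suc p)) (c1 (Suc p))
        * unfold_right (r1 (Suc p)) (n (Suc (Suc p))) (r1 (Suc (Suc p))) (c1 (Suc (Suc p)))"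
    by (rule left_stepE)
  have "left_orth n r' c' \<mu>" if "\<mu> \<in> {1..Suc p}" for \<mu>
  proof (cases "\<mu> = Suc p")
    case False
    then have "left_orth n r1 c1 \<mu>" using IH that by auto
    \<comment> \<open>Orthonormality of core \<open>\<mu>\<close> also depends on rank
      \<open>\<mu>-1\<close>, which must not be the replaced one.\<close>
    moreover have "\<mu> - 1 \<noteq> Suc p" using that by auto
    ultimately show ?thesis
      using False that left_orth_cong[of r' \<mu> r1 c' c1 n] by (auto simp: r' c')
  qed (use orth in simp)
  moreover have "tt_entry d r' c' i = tt_entry d r c i" if "\<forall>\<mu>\<in>{1..d}. i \<mu> < n \<mu>" for i
    unfolding r' c' using tt_entry_replace_pair[where n = n, OF eq, of d i] IH that Suc.prems(2)
    by simp
  moreover have "\<forall>\<nu>. \<nu> = 0 \<or> Suc p < \<nu> \<longrightarrow> r' \<nu> = r \<nu>" using IH by (auto simp: r')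
  ultimately show ?case by blast
qed

text \<open>Induction on the length of the downward sweep. Core \<open>p + 1\<close> absorbs the
  last triangular factor, so only cores up to \<open>p\<close> are claimed unchanged; this preserves
  the result of the left sweep.\<close>

lemma right_orthonormalization_invariants:
  assumes "right_orthonormalization d n (Suc (Suc p)) (r, c) (r', c')" and "Suc p \<le> d"
  shows "(\<forall>\<nu>. \<nu> \<le> p \<or> d \<le> \<nu> \<longrightarrow> r' \<nu> = r \<nu>) \<and> (\<forall>\<nu>\<le>p. c' \<nu> = c \<nu>) \<and>
    (\<forall>\<mu>\<in>{Suc (Suc p)..d}. right_orth n r' c' \<mu>) \<and>
    (\<forall>i. (\<forall>\<mu>\<in>{1..d}. i \<mu> < n \<mu>) \<longrightarrow> tt_entry d r' c' i = tt_entry d r c i)"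
  using assms
proof (induction "d - Suc p" arbitrary: p r' c')
  case 0
  then have "d = Suc p" by simp
  then show ?case using 0 by (simp add: right_orthonormalization_def)
next
  case (Suc t)
  then have less: "Suc p < d" and t: "t = d - Suc (Suc p)" by auto
  have "rev [Suc (Suc p)..<d + 1] = rev [Suc (Suc (Suc p))..<d + 1] @ [Suc (Suc p)]"
    using less by (simp add: upt_conv_Cons del: upt_Suc)
  with Suc.prems(1) obtain r1 c1
    where 1: "right_orthonormalization d n (Suc (Suc (Suc p))) (r, c) (r1, c1)"
    and 2: "right_step n (Suc (Suc p)) (r1, c1) (r', c')"
    unfolding right_orthonormalization_def by (auto simp only: sweep_snoc split_paired_Ex)
  note IH = Suc.hyps(1)[OF t 1 Suc_leI[OF less]]
  from 2 obtain s y z where r': "r' = r1(Suc p := s)" and c': "c' = c1(Suc p := y, Suc (Suc p) := z)"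
    and orth: "right_orth n r' c' (Suc (Suc p))"
    and eq: "unfold_left (r1 p) (n (Suc p)) s y
        * unfold_right s (n (Suc (Suc p))) (r1 (Suc (Suc p))) z
      = unfold_left (r1 p) (n (Suc p)) (r1 (Suc p)) (c1 (Suc p))
        * unfold_right (r1 (Suc p)) (n (Suc (Suc p))) (r1 (Suc (Suc p))) (c1 (Suc (Suc p)))"
    by (rule right_stepE)
  have "right_orth n r' c' \<mu>" if "\<mu> \<in> {Suc (Suc p)..d}" for \<mu>
  proof (cases "\<mu> = Suc (Suc p)")
    case False
    then have "right_orth n r1 c1 \<mu>" using IH that by auto
    moreover have "\<mu> - 1 \<noteq> Suc p" "\<mu> \<noteq> Suc p" using that False by auto
    ultimately show ?thesis
      using False that right_orth_cong[of r' \<mu> r1 c' c1 n] by (auto simp: r' c')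
  qed (use orth in simp)
  moreover have "tt_entry d r' c' i = tt_entry d r c i" if "\<forall>\<mu>\<in>{1..d}. i \<mu> < n \<mu>" for i
    unfolding r' c' using tt_entry_replace_pair[where n = n, OF eq, of d i] IH that less
    by simp
  moreover have "\<forall>\<nu>. \<nu> \<le> p \<or> d \<le> \<nu> \<longrightarrow> r' \<nu> = r \<nu>" "\<forall>\<nu>\<le>p. c' \<nu> = c \<nu>"
    using IH less by (auto simp: r' c')
  ultimately show ?case by blast
qed

text \<open>The new cores \<open>y\<close>, \<open>z\<close> represent the old tensor only after \<open>S\<close> is multiplied back into \<open>z\<close>.\<close>

lemma svd_stepE:
  assumes "svd_step n (Suc m) (r, c) (r', c') S"
    and C: "right_orth n r c (Suc (Suc m))"
  obtains s y z where "r' = r(Suc m := s)" "c' = c(Suc m := y, Suc (Suc m) := z)"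
    "S \<in> carrier_mat s s" "diagonal_mat S" "\<forall>k<s. S $$ (k, k) > 0"
    "left_orth n r' c' (Suc m)" "right_orth n r' c' (Suc (Suc m))"
    "unfold_left (r m) (n (Suc m)) s y * unfold_right s (n (Suc (Suc m))) (r (Suc (Suc m)))
        (\<lambda>e j b. \<Sum>e'<s. S $$ (e, e') * z e' j b)
      = unfold_left (r m) (n (Suc m)) (r (Suc m)) (c (Suc m))
        * unfold_right (r (Suc m)) (n (Suc (Suc m))) (r (Suc (Suc m))) (c (Suc (Suc m)))"
proof -
  let ?A = "unfold_left (r m) (n (Suc m)) (r (Suc m)) (c (Suc m))"
  let ?C = "unfold_right (r (Suc m)) (n (Suc (Suc m))) (r (Suc (Suc m))) (c (Suc (Suc m)))"
  let ?w = "n (Suc (Suc m)) * r (Suc (Suc m))"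
  from assms(1) obtain U V s y z where svd: "compact_svd ?A U S V" and s: "s = dim_row S"
    and y: "unfold_left (r m) (n (Suc m)) s y = U"
    and z: "unfold_right s (n (Suc (Suc m))) (r (Suc (Suc m))) z = V\<^sup>T * ?C"
    and T': "r' = r(Suc m := s)" "c' = c(Suc m := y, Suc (Suc m) := z)"
    unfolding svd_step_def by auto
  have U: "U \<in> carrier_mat (r m * n (Suc m)) s" and S: "S \<in> carrier_mat s s"
    and V: "V \<in> carrier_mat (r (Suc m)) s"
    and UU: "U\<^sup>T * U = 1\<^sub>m s" and VV: "V\<^sup>T * V = 1\<^sub>m s"
    and diag: "diagonal_mat S" "\<forall>k<s. S $$ (k, k) > 0" and A: "?A = U * S * V\<^sup>T"
    using svd s by (auto simp: compact_svd_def unfold_left_def Let_def)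
  have Cc: "?C \<in> carrier_mat (r (Suc m)) ?w" and VT: "V\<^sup>T \<in> carrier_mat s (r (Suc m))"
    and CT: "?C\<^sup>T \<in> carrier_mat ?w (r (Suc m))" and VC: "V\<^sup>T * ?C \<in> carrier_mat s ?w"
    and US: "U * S \<in> carrier_mat (r m * n (Suc m)) s"
    using V U S by auto
  \<comment> \<open>Right-orthonormality of the old core makes the inner factor cancel, so the Gram
    matrix of the rows of \<open>V\<^sup>T * ?C\<close> reduces to
    \<open>V\<^sup>T * V\<close>.\<close>
  have CC: "?C * ?C\<^sup>T = 1\<^sub>m (r (Suc m))"
    using C by (simp add: right_orth_iff)
  have "(V\<^sup>T * ?C) * (V\<^sup>T * ?C)\<^sup>T = (V\<^sup>T * ?C) * (?C\<^sup>T * V)"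
    using transpose_mult[OF VT Cc] by simp
  also have "\<dots> = V\<^sup>T * (?C * (?C\<^sup>T * V))"
    by (rule assoc_mult_mat[OF VT Cc mult_carrier_mat[OF CT V]])
  also have "\<dots> = 1\<^sub>m s"
    unfolding mult_mat_cancel_left[OF Cc CT CC V] by (rule VV)
  finally have right: "right_orth n r' c' (Suc (Suc m))"
    using z by (simp add: right_orth_iff T')
  have left: "left_orth n r' c' (Suc m)"
    using UU y by (simp add: left_orth_iff T')
  \<comment> \<open>Multiplying \<open>S\<close> into the first index of a core is left
    multiplication of its right unfolding by \<open>S\<close>.\<close>
  have "unfold_right s (n (Suc (Suc m))) (r (Suc (Suc m)))
      (\<lambda>e j b. \<Sum>e'<s. S $$ (e, e') * z e' j b) = S * (V\<^sup>T * ?C)"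
    unfolding z[symmetric] using S
    by (intro eq_matI) (auto simp: unfold_right_def scalar_prod_def lessThan_atLeast0)
  moreover have "U * (S * (V\<^sup>T * ?C)) = ?A * ?C"
    unfolding A using assoc_mult_mat[OF U S VC] assoc_mult_mat[OF US VT Cc] by simp
  ultimately show ?thesis using that[OF T' S diag left right] y by simp
qed


section \<open>Correctness of the procedure\<close>

lemma left_interface_eq:
  "left_interface n l (r, c) = mat (\<Prod>\<mu>=1..l. n \<mu>) (r l)
    (\<lambda>(p, k). left_part r c (mdigit n 1 p) l k)"
  by (simp add: left_interface_def sum_core_prod_left[unfolded One_nat_def])

lemma left_interface_gram:
  assumes "\<And>\<mu>. 1 \<le> \<mu> \<Longrightarrow> \<mu> \<le> l \<Longrightarrow> left_orth n r c \<mu>" and "r 0 = 1"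
  shows "(left_interface n l (r, c))\<^sup>T * left_interface n l (r, c) = 1\<^sub>m (r l)"
  using left_part_gram[of l n r c] assms
  by (intro eq_matI) (auto simp: left_interface_eq scalar_prod_def lessThan_atLeast0)

lemma right_interface_eq:
  "right_interface (l + t) n l (r, c) = mat (r l) (\<Prod>\<mu>=Suc l..l + t. n \<mu>)
    (\<lambda>(k, q). right_part r c (mdigit n (Suc l) q) t l k)"
  by (simp add: right_interface_def sum_core_prod_right)

lemma right_interface_gram:
  assumes "\<And>\<mu>. l < \<mu> \<Longrightarrow> \<mu> \<le> l + t \<Longrightarrow> right_orth n r c \<mu>" and "r (l + t) = 1"
  shows "right_interface (l + t) n l (r, c) * (right_interface (l + t) n l (r, c))\<^sup>T = 1\<^sub>m (r l)"
  using right_part_gram[of l t n r c] assms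
  by (intro eq_matI) (auto simp: right_interface_eq scalar_prod_def lessThan_atLeast0)

lemma mdigit_less: "n \<mu> > 0 \<Longrightarrow> mdigit n a p \<mu> < n \<mu>"
  by (simp add: mdigit_def)

text \<open>Cutting the TT-entry at \<open>l\<close> gives a matrix product. The right part is
  linear in core \<open>l + 1\<close>, so the \<open>S\<close> absorbed there can be pulled out in
  front of the right interface.\<close>

lemma matricization_eq_interfaces:
  fixes z :: core
  assumes l: "Suc l \<le> d" and S: "S \<in> carrier_mat (r l) (r l)"
    and entry: "\<And>i. i \<in> (\<Pi>\<^sub>E \<mu>\<in>{1..d}. {..<n \<mu>}) \<Longrightarrow>
      x i = tt_entry d r (c(Suc l := \<lambda>e j b. \<Sum>e'<r l. S $$ (e, e') * c (Suc l) e' j b)) i"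
  shows "matricization d n l x = left_interface n l (r, c) * S * right_interface d n l (r, c)"
proof -
  let ?M = "left_interface n l (r, c)" and ?N = "right_interface d n l (r, c)"
  let ?c = "c(Suc l := \<lambda>e j b. \<Sum>e'<r l. S $$ (e, e') * c (Suc l) e' j b)"
  obtain t where d: "d = l + Suc t" using l by (metis less_natE Suc_le_eq add_Suc_right)
  have M: "?M \<in> carrier_mat (\<Prod>\<mu>=1..l. n \<mu>) (r l)" and N: "?N \<in> carrier_mat (r l) (\<Prod>\<mu>=l+1..d. n \<mu>)"
    by (simp_all add: left_interface_def right_interface_def)
  have "matricization d n l x $$ (p, q) = (?M * (S * ?N)) $$ (p, q)"
    if p: "p < (\<Prod>\<mu>=1..l. n \<mu>)" and q: "q < (\<Prod>\<mu>=l+1..d. n \<mu>)" for p q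
  proof -
    define i where "i = (\<lambda>\<mu>\<in>{1..d}. if \<mu> \<le> l then mdigit n 1 p \<mu> else mdigit n (l+1) q \<mu>)"
    \<comment> \<open>The existence of \<open>p\<close> and \<open>q\<close> in range excludes empty
      modes, so the decoded \<open>i\<close> is a genuine multi-index.\<close>
    have "n \<mu> > 0" if "\<mu> \<in> {1..d}" for \<mu>
    proof (cases "\<mu> \<le> l")
      case True
      moreover have "(\<Prod>\<mu>=1..l. n \<mu>) \<noteq> 0" using p by linarith
      ultimately show ?thesis using that by auto
    next
      case False
      moreover have "(\<Prod>\<mu>=l+1..d. n \<mu>) \<noteq> 0" using q by linarith
      ultimately show ?thesis using that by auto
    qed
    then have i: "i \<in> (\<Pi>\<^sub>E \<mu>\<in>{1..d}. {..<n \<mu>})"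
      by (auto simp: i_def mdigit_less)
    have left: "left_part r ?c i l k = ?M $$ (p, k)" if "k < r l" for k
    proof -
      have "left_part r ?c i l k = left_part r c (mdigit n 1 p) l k"
        using l by (intro left_part_cong) (auto simp: i_def)
      then show ?thesis
        using p that by (simp add: left_interface_eq)
    qed
    have right: "right_part r ?c i (Suc t) l k = (\<Sum>k'<r l. S $$ (k, k') * ?N $$ (k', q))"
      if "k < r l" for k
    proof -
      \<comment> \<open>The modified core is the first one of this right part; the remaining cores
        agree with those of \<open>c\<close>.\<close>
      have "right_part r ?c i (Suc t) l k = (\<Sum>b<r (Suc l). (\<Sum>k'<r l. S $$ (k, k')
          * c (Suc l) k' (i (Suc l)) b) * right_part r c i t (Suc l) b)"
        using right_part_cong[of "Suc l" t r r ?c c i i] by simp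
      also have "\<dots> = (\<Sum>k'<r l. S $$ (k, k') * right_part r c i (Suc t) l k')"
        by (simp add: sum_distrib_left sum_distrib_right mult.assoc) (rule sum.swap)
      also have "\<dots> = (\<Sum>k'<r l. S $$ (k, k') * ?N $$ (k', q))"
      proof (intro sum.cong refl arg_cong2[of _ _ _ _ "(*)"])
        fix k' assume "k' \<in> {..<r l}"
        moreover have "right_part r c i (Suc t) l k'
            = right_part r c (mdigit n (Suc l) q) (Suc t) l k'"
          by (intro right_part_cong) (auto simp: i_def d)
        ultimately show "right_part r c i (Suc t) l k' = ?N $$ (k', q)"
          using q unfolding d right_interface_eq by simp
      qed
      finally show ?thesis .
    qed
    have "matricization d n l x $$ (p, q) = x i"
      using p q by (simp add: matricization_def i_def)
    also have "\<dots> = (\<Sum>k<r l. left_part r ?c i l k * right_part r ?c i (Suc t) l k)"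
      unfolding entry[OF i] tt_entry_split d ..
    also have "\<dots> = (\<Sum>k<r l. ?M $$ (p, k) * (\<Sum>k'<r l. S $$ (k, k') * ?N $$ (k', q)))"
      by (intro sum.cong refl) (simp only: left right lessThan_iff)
    also have "\<dots> = (?M * (S * ?N)) $$ (p, q)"
      using M N S p q by (auto simp: scalar_prod_def lessThan_atLeast0 intro!: sum.cong)
    finally show ?thesis .
  qed
  then have "matricization d n l x = ?M * (S * ?N)"
    using M N S by (intro eq_matI) (auto simp: matricization_def)
  then show ?thesis using assoc_mult_mat[OF M S N] by simp
qed

theorem proposition3p7:
  fixes d l :: nat and n r :: "nat \<Rightarrow> nat" and c :: "nat \<Rightarrow> core" and x :: tensor
    and M S N :: "real mat"
  assumes "d \<ge> 2"
    and "1 \<le> l" and "l \<le> d - 1"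
    and "tt_format d n (r, c) x"
    and "pseudoinverse_procedure d n l (r, c) M S N"
  shows "pseudoinverse (matricization d n l x) = N\<^sup>T * the (mat_inverse S) * M\<^sup>T"
proof -
  obtain m where l: "l = Suc m" using assms(2) by (cases l) auto
  have d: "Suc (Suc m) \<le> d" using assms(1,3) l by simp
  from assms(5) obtain r1 c1 r2 c2 r3 c3 where
    1: "left_orthonormalization n m (r, c) (r1, c1)" and
    2: "right_orthonormalization d n (Suc (Suc m)) (r1, c1) (r2, c2)" and
    3: "svd_step n (Suc m) (r2, c2) (r3, c3) S" and
    M: "M = left_interface n l (r3, c3)" and N: "N = right_interface d n l (r3, c3)"
    by (auto simp: pseudoinverse_procedure_def l)
  have "r 0 = 1" "r d = 1" using assms(4) by (auto simp: tt_format_def)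
  note left = left_orthonormalization_invariants[OF 1 Suc_leD[OF d]]
  note right = right_orthonormalization_invariants[OF 2 Suc_leD[OF d]]
  have "right_orth n r2 c2 (Suc (Suc m))" using right d by auto
  with 3 obtain s y z where
    r3: "r3 = r2(Suc m := s)" and c3: "c3 = c2(Suc m := y, Suc (Suc m) := z)" and
    S: "S \<in> carrier_mat s s" "diagonal_mat S" "\<forall>k<s. S $$ (k, k) > 0" and
    orth: "left_orth n r3 c3 (Suc m)" "right_orth n r3 c3 (Suc (Suc m))" and
    eq: "unfold_left (r2 m) (n (Suc m)) s y * unfold_right s (n (Suc (Suc m))) (r2 (Suc (Suc m)))
          (\<lambda>e j b. \<Sum>e'<s. S $$ (e, e') * z e' j b)
        = unfold_left (r2 m) (n (Suc m)) (r2 (Suc m)) (c2 (Suc m))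
          * unfold_right (r2 (Suc m)) (n (Suc (Suc m))) (r2 (Suc (Suc m))) (c2 (Suc (Suc m)))"
    by (rule svd_stepE)
  \<comment> \<open>Since \<open>0 < l < d\<close>, none of the three stages touches the boundary
    ranks.\<close>
  have r3_ends: "r3 0 = 1" "r3 d = 1" "r3 l = s"
    using left right d \<open>r 0 = 1\<close> \<open>r d = 1\<close> by (auto simp: r3 l)
  have "left_orth n r3 c3 \<mu>" if "1 \<le> \<mu>" "\<mu> \<le> l" for \<mu>
  proof (cases "\<mu> = l")
    case False
    then have "left_orth n r1 c1 \<mu>" using left that l by auto
    \<comment> \<open>For \<open>\<mu> < l\<close> neither the right sweep nor the SVD step reaches
      core \<open>\<mu>\<close> or its ranks.\<close>
    moreover have "r3 \<mu> = r1 \<mu>" "r3 (\<mu>-1) = r1 (\<mu>-1)" "c3 \<mu> = c1 \<mu>"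
      using False that right by (auto simp: r3 c3 l)
    ultimately show ?thesis using left_orth_cong[of r3 \<mu> r1 c3 c1 n] by simp
  qed (use orth l in simp)
  then have MM: "M\<^sup>T * M = 1\<^sub>m s"
    using left_interface_gram[of l n r3 c3] r3_ends by (simp add: M)
  have "right_orth n r3 c3 \<mu>" if "l < \<mu>" "\<mu> \<le> d" for \<mu>
  proof (cases "\<mu> = Suc (Suc m)")
    case False
    then have "right_orth n r2 c2 \<mu>" using right that l by auto
    moreover have "r3 \<mu> = r2 \<mu>" "r3 (\<mu>-1) = r2 (\<mu>-1)" "c3 \<mu> = c2 \<mu>"
      using False that by (auto simp: r3 c3 l)
    ultimately show ?thesis using right_orth_cong[of r3 \<mu> r2 c3 c2 n] by simp
  qed (use orth in simp)
  then have NN: "N * N\<^sup>T = 1\<^sub>m s"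
    using right_interface_gram[of l "d - l" n r3 c3] r3_ends d l by (simp add: N)
  have "x i = tt_entry d r3
      (c3(Suc l := \<lambda>e j b. \<Sum>e'<r3 l. S $$ (e, e') * c3 (Suc l) e' j b)) i"
    if i: "i \<in> (\<Pi>\<^sub>E \<mu>\<in>{1..d}. {..<n \<mu>})" for i
  proof -
    have less: "\<forall>\<mu>\<in>{1..d}. i \<mu> < n \<mu>" using i by auto
    \<comment> \<open>The second new core is taken with \<open>S\<close> multiplied in, as only this
      version has the old contraction.\<close>
    have "tt_entry d r3 (c2(Suc m := y, Suc (Suc m) := \<lambda>e j b. \<Sum>e'<s. S $$ (e, e') * z e' j b)) i
        = tt_entry d r2 c2 i"
      unfolding r3 using less d by (intro tt_entry_replace_pair[where n = n, OF eq]) auto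
    also have "\<dots> = x i"
      using left right less tt_format_entry[OF assms(4) i] by simp
    finally show ?thesis by (simp add: c3 r3_ends) (simp add: l)
  qed
  then have X: "matricization d n l x = M * S * N"
    using S(1) d l unfolding M N r3_ends(3)[symmetric]
    by (intro matricization_eq_interfaces) auto
  obtain D where D: "mat_inverse S = Some D" "D \<in> carrier_mat s s" "S * D = 1\<^sub>m s" "D * S = 1\<^sub>m s"
    using mat_inverse_diagonal[OF S(1,2)] S(3) by force
  have "M \<in> carrier_mat (dim_row M) s" "N \<in> carrier_mat s (dim_col N)"
    by (auto simp: M N left_interface_def right_interface_def r3_ends)
  then show ?thesis
    unfolding X D(1) option.sel
    by (intro pseudoinverse_eqI moore_penrose_factorization[OF _ S(1) D(2) _ MM NN D(3,4)])
qed

end
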